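(* Let $(X,d,\mu)$ be a metric measure space. The following are equivalent: 1) For all $f\in L^1_{loc}(\mu)$, $Mf(x)\ge |f|(x)$ for $\mu$-almost every $x$. 2) For all closed and totally bounded sets $F\subset \operatorname{supp}\mu$, we have $$\limsup_{r\downarrow 0}\frac{1}{\mu(B^{cl}(x,r))}\int_{B^{cl}(x,r)}\mathbf{1}_F\,d\mu=\mathbf{1}_F(x)$$ for $\mu$-almost every $x$. 3) For all $f\in L^1_{loc}(\mu)$ and all $R>0$, $M_Rf(x)\ge |f|(x)$ for $\mu$-almost every $x$. Furthermore, the same equivalence of 1), 2), 3) holds if closed balls $B^{cl}(x,r)$ are replaced by open balls $B(x,r)$ throughout (in the definitions of $M$ and $M_R$ and in condition 2)).
   Context: Open balls are $B(x,r):=\{y\in X: d(x,y)<r\}$ and closed balls are $B^{cl}(x,r):=\{y\in X: d(x,y)\le r\}$, $r>0$. Metric measure space: $(X,d)$ is a metric space and $\mu$ is a Borel measure, not identically $0$, assigning finite measure to bounded Borel sets, and $\tau$-additive, meaning that for every collection $\{U_\alpha:\alpha\in\Lambda\}$ of open sets, $\mu(\cup_\alpha U_\alpha)=\sup \mu(\cup_{i=1}^n U_{\alpha_i})$, the supremum being over all finite subcollections. ($\mu$ may also denote the completion of such a Borel measure.) The support is defined by $(\operatorname{supp}\mu)^c:=\cup\{B(x,r): x\in X,\ \mu B(x,r)=0\}$; by $\tau$-additivity $\mu(X\setminus\operatorname{supp}\mu)=0$, so a.e. statements only concern points of $\operatorname{supp}\mu$, where all balls have positive measure. A set $T$ is totally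 bounded if for every $r>0$ it can be covered by finitely many balls of radius $r$. $L^1_{loc}(\mu)$ is the set of measurable functions that are $\mu$-integrable on every ball. The centered Hardy-Littlewood maximal function is $$Mf(x):=\sup_{\{r>0:\ 0<\mu(B^{cl}(x,r))\}}\frac{1}{\mu(B^{cl}(x,r))}\int_{B^{cl}(x,r)}|f|\,d\mu,$$ and for $R>0$ the localized maximal function is $$M_Rf(x):=\sup_{\{0<r\le R:\ 0<\mu(B^{cl}(x,r))\}}\frac{1}{\mu(B^{cl}(x,r))}\int_{B^{cl}(x,r)}|f|\,d\mu.$$ *)

theory Defs
  imports "HOL-Analysis.Analysis"
begin

definition tau_additive :: "'a::topological_space measure \<Rightarrow> bool" where
  "tau_additive \<mu> \<longleftrightarrow>
     (\<forall>\<U>. (\<forall>U\<in>\<U>. open U) \<longrightarrow>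
        emeasure \<mu> (\<Union>\<U>) = (SUP \<F>\<in>{\<F>. finite \<F> \<and> \<F> \<subseteq> \<U>}. emeasure \<mu> (\<Union>\<F>)))"

definition borel_metric_measure :: "'a::metric_space measure \<Rightarrow> bool" where
  "borel_metric_measure \<mu> \<longleftrightarrow>
     sets \<mu> = sets borel \<and>
     emeasure \<mu> UNIV \<noteq> 0 \<and>
     (\<forall>A\<in>sets borel. bounded A \<longrightarrow> emeasure \<mu> A < \<infinity>) \<and>
     tau_additive \<mu>"

text \<open>The metric space is the whole type. A metric measure space carries either a Borel measure
  as above or the completion of one; both cases are covered.\<close>

definition metric_measure_space :: "'a::metric_space measure \<Rightarrow> bool" where
  "metric_measure_space \<mu> \<longleftrightarrow>
     (\<exists>\<nu>. borel_metric_measure \<nu> \<and> (\<mu> = \<nu> \<or> \<mu> = completion \<nu>))"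

definition msupp :: "'a::metric_space measure \<Rightarrow> 'a set" where
  "msupp \<mu> = - (\<Union>{ball x r | x r. 0 < r \<and> emeasure \<mu> (ball x r) = 0})"

definition L1_loc :: "'a::metric_space measure \<Rightarrow> ('a \<Rightarrow> real) set" where
  "L1_loc \<mu> = {f \<in> borel_measurable \<mu>. \<forall>x. \<forall>r>0. set_integrable \<mu> (ball x r) f}"

text \<open>In the following, the parameter \<open>B\<close> stands for the system of balls in use: it is
  instantiated by \<^const>\<open>cball\<close> or by \<^const>\<open>ball\<close>. Averages and suprema take values in
  \<^typ>\<open>ennreal\<close>, since maximal functions may be infinite. For a function
  \<open>f\<close> in \<open>L1_loc\<close>, the nonnegative integral of \<open>|f|\<close> over a ball is its (finite) Lebesgue integral.\<close>

definition ball_average ::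
  "('a \<Rightarrow> real \<Rightarrow> 'a set) \<Rightarrow> 'a measure \<Rightarrow> ('a \<Rightarrow> ennreal) \<Rightarrow> 'a \<Rightarrow> real \<Rightarrow> ennreal" where
  "ball_average B \<mu> g x r = (\<integral>\<^sup>+ y\<in>B x r. g y \<partial>\<mu>) / emeasure \<mu> (B x r)"

definition maximal_function ::
  "('a \<Rightarrow> real \<Rightarrow> 'a set) \<Rightarrow> 'a measure \<Rightarrow> ('a \<Rightarrow> real) \<Rightarrow> 'a \<Rightarrow> ennreal" where
  "maximal_function B \<mu> f x =
     (SUP r\<in>{r. 0 < r \<and> 0 < emeasure \<mu> (B x r)}. ball_average B \<mu> (\<lambda>y. ennreal \<bar>f y\<bar>) x r)"

definition local_maximal_function ::
  "('a \<Rightarrow> real \<Rightarrow> 'a set) \<Rightarrow> 'a measure \<Rightarrow> real \<Rightarrow> ('a \<Rightarrow> real) \<Rightarrow> 'a \<Rightarrow> ennreal" where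
  "local_maximal_function B \<mu> R f x =
     (SUP r\<in>{r. 0 < r \<and> r \<le> R \<and> 0 < emeasure \<mu> (B x r)}.
        ball_average B \<mu> (\<lambda>y. ennreal \<bar>f y\<bar>) x r)"

end

(* For 1) => 2), test 1) on the indicator of a piece A of F of diameter less than R. Balls of radius
   r > R cannot help: around x in A they give A at most the average that the ball of radius R gives
   to F. Hence the averages of F over radii at most R have supremum at least 1 almost everywhere
   on F, and R is arbitrary.
   For 2) => 3), tau-additivity makes the measure inner regular with respect to closed totally
   bounded subsets of the support. So almost all of {|f| > q} is covered by countably many such F;
   by 2) the localized maximal function is at least q almost everywhere on each of them, and q
   runs through the rationals. *)

theory Submission
  imports Defs
begin

section \<open>Inner regularity by closed totally bounded sets\<close>

lemma emeasure_UN_le_geometric: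
  fixes A :: "nat \<Rightarrow> 'a set"
  assumes "\<And>n. A n \<in> sets M" and "\<And>n. emeasure M (A n) \<le> ennreal (e * (1/2) ^ Suc n)" and "0 \<le> e"
  shows "emeasure M (\<Union>n. A n) \<le> ennreal e"
proof -
  have sums: "(\<lambda>n. e * (1/2) ^ Suc n) sums e"
    using sums_mult[OF power_half_series, of e] by simp
  have "emeasure M (\<Union>n. A n) \<le> (\<Sum>n. emeasure M (A n))"
    using assms(1) by (intro emeasure_subadditive_countably) auto
  also have "\<dots> \<le> (\<Sum>n. ennreal (e * (1/2) ^ Suc n))"
    using assms(2) by (intro suminf_le) auto
  also have "\<dots> = ennreal (\<Sum>n. e * (1/2) ^ Suc n)"
    using assms(3) sums by (intro suminf_ennreal2) (auto dest: sums_summable)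
  also have "\<dots> = ennreal e"
    using sums by (simp add: sums_iff)
  finally show ?thesis .
qed

lemma emeasure_decseq_small:
  fixes A :: "nat \<Rightarrow> 'a set" and e :: real
  assumes "\<And>n. A n \<in> sets M" and "decseq A" and "emeasure M (A 0) < \<infinity>" and "(\<Inter>n. A n) = {}" and "0 < e"
  shows "\<exists>n. emeasure M (A n) \<le> ennreal e"
proof -
  have fin: "emeasure M (A n) \<noteq> \<infinity>" for n
    using emeasure_mono[of "A n" "A 0" M] assms(1,3) decseqD[OF assms(2), of 0 n]
    by (auto simp: top_unique)
  have "(\<lambda>n. emeasure M (A n)) \<longlonglongrightarrow> emeasure M (\<Inter>n. A n)"
    using assms(1,2) fin by (intro Lim_emeasure_decseq) auto
  then have "(\<lambda>n. emeasure M (A n)) \<longlonglongrightarrow> 0"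
    using assms(4) by simp
  then have "eventually (\<lambda>n. emeasure M (A n) < ennreal e) sequentially"
    using assms(5) by (intro order_tendstoD) auto
  then obtain N where "\<forall>n\<ge>N. emeasure M (A n) < ennreal e"
    by (auto simp: eventually_sequentially)
  then show ?thesis
    by (intro exI[of _ N]) (simp add: less_imp_le)
qed

text \<open>The sets that can be approximated from both sides form a \<sigma>-algebra containing the
  closed sets: complementation swaps \<open>C\<close> and \<open>U\<close> and leaves the gap
  \<open>U - C\<close> unchanged. \<open>M\<close> may be infinite, so gaps are measured inside a
  set \<open>S\<close> of finite measure, where continuity from above is available.\<close>

lemma closed_open_approximation:
  fixes M :: "'a::metric_space measure" and e :: real
  assumes sets_M: "sets M = sets borel" and S: "S \<in> sets borel" and fin: "emeasure M S < \<infinity>"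
    and "A \<in> sets borel" and "0 < e"
  shows "\<exists>C U. closed C \<and> open U \<and> C \<subseteq> A \<and> A \<subseteq> U \<and> emeasure M (S \<inter> (U - C)) \<le> ennreal e"
proof -
  have finS: "emeasure M (S \<inter> T) < \<infinity>" if "T \<in> sets borel" for T
    using emeasure_mono[of "S \<inter> T" S M] S fin sets_M by (auto simp: less_top[symmetric] top_unique)
  have "A \<in> sigma_sets UNIV (Collect closed)"
    using \<open>A \<in> sets borel\<close> by (simp add: borel_eq_closed)
  then show ?thesis
    using \<open>0 < e\<close>
  proof (induction arbitrary: e rule: sigma_sets.induct)
    case (Basic A)
    then have "closed A" by simp
    \<comment> \<open>The neighbourhoods of radius 1/(n+1) decrease to the closure of
      \<open>A\<close>, hence to \<open>A\<close> itself.\<close>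
    define U where "U n = (\<Union>a\<in>A. ball a (inverse (real (Suc n))))" for n
    have "open (U n)" "A \<subseteq> U n" for n
      unfolding U_def by auto
    have "(\<Inter>n. U n) \<subseteq> A"
    proof
      fix x assume x: "x \<in> (\<Inter>n. U n)"
      have "\<exists>a\<in>A. dist a x < d" if "0 < d" for d
      proof -
        obtain n where "inverse (real (Suc n)) < d"
          using reals_Archimedean[OF \<open>0 < d\<close>] by auto
        moreover have "x \<in> U n" using x by blast
        ultimately show ?thesis unfolding U_def by force
      qed
      then show "x \<in> A"
        using \<open>closed A\<close> closure_approachable[of x A] by auto
    qed
    then have "(\<Inter>n. S \<inter> (U n - A)) = {}" by blast
    moreover have "decseq (\<lambda>n. S \<inter> (U n - A))"
    proof (rule decseq_SucI)
      fix n
      have "inverse (real (Suc (Suc n))) \<le> inverse (real (Suc n))"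
        by (rule le_imp_inverse_le) auto
      then have "U (Suc n) \<subseteq> U n"
        unfolding U_def by (intro UN_mono subset_ball order_refl)
      then show "S \<inter> (U (Suc n) - A) \<subseteq> S \<inter> (U n - A)" by blast
    qed
    moreover have "S \<inter> (U n - A) \<in> sets M" for n
      using S sets_M \<open>open (U n)\<close> \<open>closed A\<close> by auto
    moreover have "emeasure M (S \<inter> (U 0 - A)) < \<infinity>"
      using \<open>open (U 0)\<close> \<open>closed A\<close> by (intro finS) auto
    ultimately obtain n where "emeasure M (S \<inter> (U n - A)) \<le> ennreal e"
      using emeasure_decseq_small[of "\<lambda>n. S \<inter> (U n - A)" M e] Basic by auto
    then show ?case
      using \<open>closed A\<close> \<open>open (U n)\<close> \<open>A \<subseteq> U n\<close> by blast
  next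
    case Empty
    show ?case by (intro exI[of _ "{}"]) auto
  next
    case (Compl A)
    obtain C U where "closed C" "open U" "C \<subseteq> A" "A \<subseteq> U"
      and "emeasure M (S \<inter> (U - C)) \<le> ennreal e"
      using Compl.IH[OF Compl.prems] by blast
    moreover have "- C - - U = U - C" by auto
    ultimately have "closed (- U) \<and> open (- C) \<and> - U \<subseteq> UNIV - A \<and> UNIV - A \<subseteq> - C \<and>
        emeasure M (S \<inter> (- C - - U)) \<le> ennreal e"
      by (simp only:) auto
    then show ?case by blast
  next
    case (Union A)
    \<comment> \<open>One half of \<open>e\<close> pays for all the gaps \<open>U n - C n\<close>
      together. The other half is kept for cutting the union of the \<open>C k\<close> down to
      finitely many, since the whole union need not be closed.\<close>
    have "\<exists>C U. closed C \<and> open U \<and> C \<subseteq> A n \<and> A n \<subseteq> U \<and>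
        emeasure M (S \<inter> (U - C)) \<le> ennreal ((e/2) * (1/2) ^ Suc n)" for n
      using Union.prems by (intro Union.IH) auto
    then obtain C U where CU: "\<And>n. closed (C n)" "\<And>n. open (U n)" "\<And>n. C n \<subseteq> A n" "\<And>n. A n \<subseteq> U n"
      "\<And>n. emeasure M (S \<inter> (U n - C n)) \<le> ennreal ((e/2) * (1/2) ^ Suc n)" by metis
    have bC: "C n \<in> sets borel" and bU: "U n \<in> sets borel" for n
      using CU by auto
    \<comment> \<open>\<open>D n\<close> is what the first \<open>n\<close> closed sets miss of
      their full union. It decreases to the empty set, so its measure inside \<open>S\<close>
      becomes small.\<close>
    define D where "D n = (\<Union>k. C k) - (\<Union>k<n. C k)" for n
    have bD: "D n \<in> sets borel" for n
      unfolding D_def using bC by auto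
    have dec: "decseq (\<lambda>n. S \<inter> D n)"
      unfolding D_def by (rule decseq_SucI) auto
    have emp: "(\<Inter>n. S \<inter> D n) = {}"
      unfolding D_def by auto
    obtain n where n: "emeasure M (S \<inter> D n) \<le> ennreal (e/2)"
      using emeasure_decseq_small[of "\<lambda>n. S \<inter> D n" M "e/2", OF _ dec finS[OF bD] emp]
        bD S sets_M Union.prems by auto
    have "S \<inter> ((\<Union>k. U k) - (\<Union>k<n. C k)) \<subseteq> (\<Union>k. S \<inter> (U k - C k)) \<union> S \<inter> D n"
      unfolding D_def by auto
    then have "emeasure M (S \<inter> ((\<Union>k. U k) - (\<Union>k<n. C k))) \<le>
        emeasure M ((\<Union>k. S \<inter> (U k - C k)) \<union> S \<inter> D n)"
      using bC bU bD S sets_M by (intro emeasure_mono) auto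
    also have "\<dots> \<le> emeasure M (\<Union>k. S \<inter> (U k - C k)) + emeasure M (S \<inter> D n)"
      using bC bU bD S sets_M by (intro emeasure_subadditive) auto
    also have "\<dots> \<le> ennreal (e/2) + ennreal (e/2)"
      using bC bU bD S sets_M Union.prems CU(5) n
      by (intro add_mono emeasure_UN_le_geometric) auto
    also have "\<dots> = ennreal e"
      using Union.prems by (simp flip: ennreal_plus)
    finally have "emeasure M (S \<inter> ((\<Union>k. U k) - (\<Union>k<n. C k))) \<le> ennreal e" .
    moreover have "closed (\<Union>k<n. C k)" "open (\<Union>k. U k)"
      using CU by auto
    moreover have "(\<Union>k<n. C k) \<subseteq> (\<Union>k. A k)" "(\<Union>k. A k) \<subseteq> (\<Union>k. U k)"
      using CU(3,4) by fast+
    ultimately show ?case by blast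
  qed
qed

section \<open>The support and consequences of \<tau>-additivity\<close>

lemma msupp_closed: "closed (msupp \<mu>)"
  unfolding msupp_def by (intro closed_Compl open_Union) auto

lemma borel_metric_measureD:
  assumes "borel_metric_measure \<nu>"
  shows "sets \<nu> = sets borel" and "\<And>A. A \<in> sets borel \<Longrightarrow> bounded A \<Longrightarrow> emeasure \<nu> A < \<infinity>"
    and "tau_additive \<nu>"
  using assms unfolding borel_metric_measure_def by auto

lemma tau_additiveD:
  assumes "tau_additive \<nu>" and "\<And>U. U \<in> \<U> \<Longrightarrow> open U"
  shows "emeasure \<nu> (\<Union>\<U>) = (SUP \<F>\<in>{\<F>. finite \<F> \<and> \<F> \<subseteq> \<U>}. emeasure \<nu> (\<Union>\<F>))"
  by (rule assms(1)[unfolded tau_additive_def, rule_format, OF assms(2)])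

text \<open>The union of null balls may be uncountable. By \<tau>-additivity its measure is the
  supremum over finite subunions, and each of these is null.\<close>

lemma msupp_compl_null:
  assumes "borel_metric_measure \<nu>"
  shows "emeasure \<nu> (- msupp \<nu>) = 0"
proof -
  let ?U = "{ball x r | x r. 0 < r \<and> emeasure \<nu> (ball x r) = 0}"
  have "emeasure \<nu> (\<Union>\<F>) = 0" if "finite \<F>" "\<F> \<subseteq> ?U" for \<F>
  proof -
    have "(\<Union>X\<in>\<F>. X) \<in> null_sets \<nu>"
      using that borel_metric_measureD(1)[OF assms]
      by (intro null_sets.finite_UN) (auto simp: null_sets_def)
    then show ?thesis by (auto dest: null_setsD1)
  qed
  then have "emeasure \<nu> (\<Union>?U) = 0"
    by (subst tau_additiveD[OF borel_metric_measureD(3)[OF assms]]) (auto intro!: SUP_eq_const)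
  then show ?thesis unfolding msupp_def by simp
qed

text \<open>Applying \<open>\<tau>\<close>-additivity to the balls of radius \<open>d\<close> covering \<open>V\<close> takes the place of separability of
  the support.\<close>

lemma finite_ball_cover_approximation:
  fixes \<nu> :: "'a::metric_space measure" and d e :: real
  assumes \<nu>: "borel_metric_measure \<nu>" and "open V" and "bounded V" and "0 < d" and "0 < e"
  shows "\<exists>D. finite D \<and> emeasure \<nu> (V - (\<Union>c\<in>D. ball c d)) \<le> ennreal e"
proof (cases "emeasure \<nu> V = 0")
  case True
  then show ?thesis by (intro exI[of _ "{}"]) auto
next
  case False
  note s = borel_metric_measureD(1)[OF \<nu>]
  have fin: "emeasure \<nu> V < \<infinity>"
    using assms borel_metric_measureD(2)[OF \<nu>] by auto
  \<comment> \<open>Intersecting with \<open>V\<close> makes the union of the family exactly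
    \<open>V\<close>, which has finite measure.\<close>
  let ?U = "range (\<lambda>c. V \<inter> ball c d)"
  have UV: "\<Union>?U = V" using \<open>0 < d\<close> by auto (metis dist_self)
  have "emeasure \<nu> V = (SUP \<F>\<in>{\<F>. finite \<F> \<and> \<F> \<subseteq> ?U}. emeasure \<nu> (\<Union>\<F>))"
    using tau_additiveD[OF borel_metric_measureD(3)[OF \<nu>], of ?U] UV \<open>open V\<close> by auto
  \<comment> \<open>Strictness is the reason for treating the null case apart: truncated subtraction
    gives 0 - \<open>e\<close> = 0.\<close>
  moreover have "emeasure \<nu> V - ennreal e < emeasure \<nu> V"
    using False fin \<open>0 < e\<close> by (intro ennreal_between) (auto simp: zero_less_iff_neq_zero)
  ultimately have "\<exists>\<F>. finite \<F> \<and> \<F> \<subseteq> ?U \<and> emeasure \<nu> V - ennreal e < emeasure \<nu> (\<Union>\<F>)"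
    by (auto simp: less_SUP_iff)
  then obtain \<F> where F: "finite \<F>" "\<F> \<subseteq> ?U" "emeasure \<nu> V - ennreal e < emeasure \<nu> (\<Union>\<F>)"
    by blast
  then obtain D where D: "finite D" "\<F> = (\<lambda>c. V \<inter> ball c d) ` D"
    by (metis finite_subset_image subset_UNIV)
  have eq: "\<Union>\<F> = V \<inter> (\<Union>c\<in>D. ball c d)"
    using D by auto
  have "V - (\<Union>c\<in>D. ball c d) = V - \<Union>\<F>"
    using eq by auto
  moreover have "emeasure \<nu> (V - \<Union>\<F>) = emeasure \<nu> V - emeasure \<nu> (\<Union>\<F>)"
  proof (rule emeasure_Diff)
    show "\<Union>\<F> \<in> sets \<nu>"
      unfolding eq s by (intro borel_open open_Int open_UN ballI open_ball \<open>open V\<close>)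
    show "emeasure \<nu> (\<Union>\<F>) \<noteq> \<infinity>"
      using fin emeasure_mono[of "\<Union>\<F>" V \<nu>] eq s \<open>open V\<close> by (auto simp: top_unique)
  qed (use eq s \<open>open V\<close> in auto)
  moreover have "emeasure \<nu> V - emeasure \<nu> (\<Union>\<F>) \<le> ennreal e"
  proof -
    have "emeasure \<nu> V \<le> ennreal e + emeasure \<nu> (\<Union>\<F>)"
      using less_imp_le[OF F(3)] unfolding ennreal_minus_le_iff by blast
    then show ?thesis
      unfolding ennreal_minus_le_iff using fin by (auto simp: add.commute)
  qed
  ultimately have "emeasure \<nu> (V - (\<Union>c\<in>D. ball c d)) \<le> ennreal e"
    by (simp only:)
  then show ?thesis
    using D(1) by blast
qed

text \<open>At each scale 1/(n+1), finitely many balls cover \<open>V\<close> up to measure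
  e/2^(n+1). Intersecting these finite unions over all \<open>n\<close> gives a set with finite
  covers at every scale, and the losses add up to at most \<open>e\<close>. Passing to closed balls
  makes the intersection closed. The space need not be complete, so \<open>K\<close> need not be
  compact.\<close>

lemma totally_bounded_approximation:
  fixes \<nu> :: "'a::metric_space measure" and e :: real
  assumes \<nu>: "borel_metric_measure \<nu>" and V: "open V" "bounded V" and e: "0 < e"
  shows "\<exists>K. closed K \<and> totally_bounded K \<and> emeasure \<nu> (V - K) \<le> ennreal e"
proof -
  note s = borel_metric_measureD(1)[OF \<nu>]
  have "\<exists>D. finite D \<and> emeasure \<nu> (V - (\<Union>c\<in>D. ball c (inverse (Suc n)))) \<le> ennreal (e * (1/2)^Suc n)"
    for n
    using e by (intro finite_ball_cover_approximation \<nu> V) auto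
  then obtain D where D: "\<And>n. finite (D n)"
    "\<And>n. emeasure \<nu> (V - (\<Union>c\<in>D n. ball c (inverse (Suc n)))) \<le> ennreal (e * (1/2)^Suc n)"
    by metis
  define K where "K = (\<Inter>n. \<Union>c\<in>D n. cball c (inverse (Suc n)))"
  have "closed K"
    unfolding K_def using D(1) by auto
  have "totally_bounded K"
    unfolding totally_bounded_metric
  proof (intro allI impI)
    fix d :: real assume "0 < d"
    then obtain n where "inverse (real (Suc n)) < d"
      using reals_Archimedean by auto
    then have "K \<subseteq> (\<Union>x\<in>D n. {y. dist x y < d})"
      unfolding K_def by force
    then show "\<exists>k. finite k \<and> K \<subseteq> (\<Union>x\<in>k. {y. dist x y < d})"
      using D(1) by blast
  qed
  have sW: "V - (\<Union>c\<in>D n. ball c (inverse (Suc n))) \<in> sets \<nu>" for n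
    unfolding s by (intro sets.Diff borel_open open_UN ballI V(1) open_ball)
  have "emeasure \<nu> (V - K) \<le> emeasure \<nu> (\<Union>n. V - (\<Union>c\<in>D n. ball c (inverse (Suc n))))"
  proof (rule emeasure_mono)
    show "V - K \<subseteq> (\<Union>n. V - (\<Union>c\<in>D n. ball c (inverse (Suc n))))"
      unfolding K_def by fastforce
    show "(\<Union>n. V - (\<Union>c\<in>D n. ball c (inverse (Suc n)))) \<in> sets \<nu>"
      using sW by (intro sets.countable_UN) auto
  qed
  also have "\<dots> \<le> ennreal e"
    using sW D(2) e by (intro emeasure_UN_le_geometric) auto
  finally show ?thesis
    using \<open>closed K\<close> \<open>totally_bounded K\<close> by blast
qed

text \<open>A closed subset of \<open>A\<close> and a closed totally bounded set, each good up to a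
  small error within a bounded ball, are intersected with each other and with the support. Letting
  the error tend to 0 and the ball grow leaves only a null part of \<open>A\<close>.\<close>

lemma borel_exhaustion:
  fixes \<nu> :: "'a::metric_space measure"
  assumes \<nu>: "borel_metric_measure \<nu>" and A: "A \<in> sets borel"
  shows "\<exists>F :: nat \<times> nat \<Rightarrow> 'a set.
    (\<forall>i. closed (F i) \<and> totally_bounded (F i) \<and> F i \<subseteq> A \<inter> msupp \<nu>) \<and> A - (\<Union>i. F i) \<in> null_sets \<nu>"
proof -
  note s = borel_metric_measureD(1)[OF \<nu>]
  fix x0 :: 'a
  define V where "V n = ball x0 (real n)" for n
  have V: "open (V n)" "bounded (V n)" "V n \<in> sets borel" for n
    unfolding V_def by auto
  have finV: "emeasure \<nu> (V n) < \<infinity>" for n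
    using V borel_metric_measureD(2)[OF \<nu>] by auto
  have "\<exists>C. closed C \<and> C \<subseteq> A \<and> emeasure \<nu> (V n \<inter> (A - C)) \<le> ennreal (inverse (Suc m))" for n m
  proof -
    obtain C U where "closed C" "open U" "C \<subseteq> A" "A \<subseteq> U"
      and le: "emeasure \<nu> (V n \<inter> (U - C)) \<le> ennreal (inverse (Suc m))"
      using closed_open_approximation[OF s V(3) finV A, of "inverse (Suc m)" n] by auto
    moreover have "emeasure \<nu> (V n \<inter> (A - C)) \<le> emeasure \<nu> (V n \<inter> (U - C))"
      using s V(3) \<open>open U\<close> \<open>closed C\<close> \<open>A \<subseteq> U\<close> by (intro emeasure_mono) auto
    ultimately show ?thesis by (meson order_trans)
  qed
  then obtain C where C: "\<And>n m. closed (C n m)" "\<And>n m. C n m \<subseteq> A"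
    "\<And>n m. emeasure \<nu> (V n \<inter> (A - C n m)) \<le> ennreal (inverse (Suc m))"
    by metis
  have "\<exists>K. closed K \<and> totally_bounded K \<and> emeasure \<nu> (V n - K) \<le> ennreal (inverse (Suc m))" for n m
    using V by (intro totally_bounded_approximation \<nu>) auto
  then obtain K where K: "\<And>n m. closed (K n m)" "\<And>n m. totally_bounded (K n m)"
    "\<And>n m. emeasure \<nu> (V n - K n m) \<le> ennreal (inverse (Suc m))"
    by metis
  \<comment> \<open>The first index \<open>n\<close> is the radius of the ball \<open>V n\<close> to
    which errors are confined; the second index \<open>m\<close> stands for the accuracy
    1/(m+1).\<close>
  define F where "F = (\<lambda>(n, m). C n m \<inter> K n m \<inter> msupp \<nu>)"
  have Fcl: "closed (F i)" for i
    unfolding F_def using C(1) K(1) msupp_closed by (auto split: prod.split intro!: closed_Int)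
  have Ftb: "totally_bounded (F i)" for i
    unfolding F_def using K(2) by (auto split: prod.split intro: totally_bounded_subset)
  have FA: "F i \<subseteq> A \<inter> msupp \<nu>" for i
    unfolding F_def using C(2) by (auto split: prod.split)
  define E where "E = A - (\<Union>i. F i)"
  have E: "E \<in> sets borel"
    unfolding E_def using A Fcl by (intro sets.Diff sets.countable_UN') auto
  have null_supp: "- msupp \<nu> \<in> null_sets \<nu>"
    using msupp_compl_null[OF \<nu>] s msupp_closed[of \<nu>] by (auto simp: null_sets_def)
  have "V n \<inter> E \<in> null_sets \<nu>" for n
  proof -
    have "emeasure \<nu> (V n \<inter> E) \<le> ennreal (2 * inverse (Suc m))" for m
    proof -
      let ?P = "V n \<inter> (A - C n m)" and ?Q = "V n - K n m"
      have "V n \<inter> E \<subseteq> (?P \<union> ?Q) \<union> - msupp \<nu>"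
        unfolding E_def F_def by auto
      moreover have sP: "?P \<in> sets \<nu>" and sQ: "?Q \<in> sets \<nu>"
        using s V(3) A C(1) K(1) by auto
      ultimately have "emeasure \<nu> (V n \<inter> E) \<le> emeasure \<nu> ((?P \<union> ?Q) \<union> - msupp \<nu>)"
        using null_supp by (intro emeasure_mono) auto
      also have "\<dots> = emeasure \<nu> (?P \<union> ?Q)"
        using null_supp sP sQ by (intro emeasure_Un_null_set) auto
      also have "\<dots> \<le> emeasure \<nu> ?P + emeasure \<nu> ?Q"
        using sP sQ by (rule emeasure_subadditive)
      also have "\<dots> \<le> ennreal (inverse (Suc m)) + ennreal (inverse (Suc m))"
        using C(3) K(3) by (rule add_mono)
      also have "\<dots> = ennreal (2 * inverse (Suc m))"
        by (simp flip: ennreal_plus)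
      finally show ?thesis .
    qed
    moreover have "(\<lambda>m. ennreal (2 * inverse (Suc m))) \<longlonglongrightarrow> ennreal (2 * 0)"
      by (intro tendsto_ennrealI tendsto_mult tendsto_const LIMSEQ_inverse_real_of_nat)
    ultimately have "emeasure \<nu> (V n \<inter> E) \<le> ennreal (2 * 0)"
      by (intro LIMSEQ_le_const) auto
    then show ?thesis
      using s V(3) E by (auto simp: null_sets_def)
  qed
  then have "(\<Union>n. V n \<inter> E) \<in> null_sets \<nu>"
    by (rule null_sets_UN)
  moreover have "(\<Union>n. V n \<inter> E) = E"
    unfolding V_def using reals_Archimedean2 by auto
  ultimately show ?thesis
    using Fcl Ftb FA unfolding E_def by (intro exI[of _ F]) auto
qed

lemma msupp_completion:
  assumes "borel_metric_measure \<nu>"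
  shows "msupp (completion \<nu>) = msupp \<nu>"
proof -
  have "emeasure (completion \<nu>) (ball x r) = emeasure \<nu> (ball x r)" for x r
  proof -
    have "ball x r \<in> sets \<nu>"
      unfolding borel_metric_measureD(1)[OF assms] by (rule borel_open[OF open_ball])
    then show ?thesis
      by (simp only: emeasure_completion main_part sets_completionI_sets)
  qed
  then show ?thesis
    unfolding msupp_def by (simp only:)
qed

text \<open>A set measurable for the completion differs from a Borel set only by part of a null set,
  so the sets exhausting the Borel part serve for it as well.\<close>

lemma measurable_exhaustion:
  fixes \<mu> :: "'a::metric_space measure"
  assumes "metric_measure_space \<mu>" and A: "A \<in> sets \<mu>"
  shows "\<exists>F :: nat \<times> nat \<Rightarrow> 'a set.
    (\<forall>i. closed (F i) \<and> totally_bounded (F i) \<and> F i \<subseteq> A \<inter> msupp \<mu>) \<and> A - (\<Union>i. F i) \<in> null_sets \<mu>"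
proof -
  obtain \<nu> where \<nu>: "borel_metric_measure \<nu>" and "\<mu> = \<nu> \<or> \<mu> = completion \<nu>"
    using assms(1) unfolding metric_measure_space_def by blast
  note s = borel_metric_measureD(1)[OF \<nu>]
  from \<open>\<mu> = \<nu> \<or> \<mu> = completion \<nu>\<close> show ?thesis
  proof
    assume "\<mu> = \<nu>"
    then show ?thesis using borel_exhaustion[OF \<nu>, of A] A s by simp
  next
    assume \<mu>: "\<mu> = completion \<nu>"
    then obtain S N N' where A': "A = S \<union> N" "N \<subseteq> N'" "N' \<in> null_sets \<nu>" "S \<in> sets \<nu>"
      using A by (auto elim: sets_completionE)
    obtain F :: "nat \<times> nat \<Rightarrow> 'a set" where F: "\<And>i. closed (F i)" "\<And>i. totally_bounded (F i)"
      "\<And>i. F i \<subseteq> S \<inter> msupp \<nu>" "S - (\<Union>i. F i) \<in> null_sets \<nu>"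
      using borel_exhaustion[OF \<nu>, of S] A'(4) unfolding s by blast
    have "A - (\<Union>i. F i) \<subseteq> (S - (\<Union>i. F i)) \<union> N'"
      using A' by auto
    then have "A - (\<Union>i. F i) \<in> null_sets \<mu>"
      unfolding \<mu> null_sets_completion_iff2 using F(4) A'(3) by blast
    moreover have "F i \<subseteq> A \<inter> msupp \<mu>" for i
      using F(3)[of i] A'(1) msupp_completion[OF \<nu>] \<mu> by blast
    ultimately show ?thesis
      using F(1,2) by (intro exI[of _ F]) blast
  qed
qed

section \<open>Maximal functions for a system of balls\<close>

lemma inverse_ennreal_antimono:
  fixes a b :: ennreal
  shows "a \<le> b \<Longrightarrow> inverse b \<le> inverse a"
  including ennreal.lifting by transfer (rule ereal_inverse_antimono, auto)

lemma Limsup_at_right_le_SUP: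
  fixes g :: "real \<Rightarrow> 'b::complete_lattice"
  assumes "0 < R"
  shows "Limsup (at_right 0) g \<le> (SUP r\<in>{0<..R}. g r)"
proof -
  have "eventually (\<lambda>r. 0 < r \<and> r \<le> R) (at_right 0)"
    unfolding eventually_at_right_field using assms by (intro exI[of _ R]) auto
  then have "Limsup (at_right 0) g \<le> (SUP r\<in>Collect (\<lambda>r. 0 < r \<and> r \<le> R). g r)"
    unfolding Limsup_def by (intro INF_lower2[where i = "\<lambda>r. 0 < r \<and> r \<le> R"]) auto
  also have "Collect (\<lambda>r. 0 < r \<and> r \<le> R) = {0<..R}" by auto
  finally show ?thesis .
qed

text \<open>Every neighbourhood of 0 from the right contains an interval with right end 1/(n+1).
  Countably many bounds therefore suffice, which matters when each of them holds only almost
  everywhere.\<close>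

lemma le_Limsup_at_right:
  fixes g :: "real \<Rightarrow> 'b::complete_lattice"
  assumes "\<And>n. c \<le> (SUP r\<in>{0<..inverse (real (Suc n))}. g r)"
  shows "c \<le> Limsup (at_right 0) g"
  unfolding Limsup_def
proof (rule INF_greatest)
  fix P :: "real \<Rightarrow> bool" assume "P \<in> {P. eventually P (at_right 0)}"
  then obtain b where b: "0 < b" "\<And>y. 0 < y \<Longrightarrow> y < b \<Longrightarrow> P y"
    by (auto simp: eventually_at_right_field)
  obtain n where "inverse (real (Suc n)) < b"
    using reals_Archimedean[OF b(1)] by auto
  then have "{0<..inverse (real (Suc n))} \<subseteq> Collect P"
    using b(2) by auto
  then have "(SUP r\<in>{0<..inverse (real (Suc n))}. g r) \<le> Sup (g ` Collect P)"
    by (intro SUP_subset_mono) auto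
  then show "c \<le> Sup (g ` Collect P)"
    using assms[of n] by (rule order_trans[rotated])
qed

text \<open>These properties are all that the argument takes from the balls: sets between open and
  closed balls, increasing in the radius and Borel. Both versions of the theorem are
  instances.\<close>

locale ball_system =
  fixes \<mu> :: "'a::metric_space measure" and B :: "'a \<Rightarrow> real \<Rightarrow> 'a set"
  assumes mms: "metric_measure_space \<mu>"
    and ball_subset: "ball x r \<subseteq> B x r"
    and subset_cball: "B x r \<subseteq> cball x r"
    and B_mono: "r \<le> s \<Longrightarrow> B x r \<subseteq> B x s"
    and B_borel: "B x r \<in> sets borel"
begin

lemma space_\<mu>: "space \<mu> = UNIV"
  and borel_sets: "A \<in> sets borel \<Longrightarrow> A \<in> sets \<mu>"
  and bounded_finite: "A \<in> sets borel \<Longrightarrow> bounded A \<Longrightarrow> emeasure \<mu> A < \<infinity>"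
proof -
  obtain \<nu> where \<nu>: "borel_metric_measure \<nu>" "\<mu> = \<nu> \<or> \<mu> = completion \<nu>"
    using mms unfolding metric_measure_space_def by blast
  note s = borel_metric_measureD(1)[OF \<nu>(1)]
  show "space \<mu> = UNIV"
    using \<nu>(2) sets_eq_imp_space_eq[OF s] by auto
  show "A \<in> sets borel \<Longrightarrow> A \<in> sets \<mu>"
    using \<nu>(2) s by auto
  show "A \<in> sets borel \<Longrightarrow> bounded A \<Longrightarrow> emeasure \<mu> A < \<infinity>"
    using \<nu>(2) s borel_metric_measureD(2)[OF \<nu>(1), of A] by auto
qed

lemma B_sets [measurable, simp]: "B x r \<in> sets \<mu>"
  by (intro borel_sets B_borel)

lemma B_finite: "emeasure \<mu> (B x r) < \<infinity>"
  by (rule bounded_finite[OF B_borel bounded_subset[OF bounded_cball subset_cball]])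

section \<open>Averages of indicator functions\<close>

lemma ball_average_indicator:
  assumes "A \<in> sets \<mu>"
  shows "ball_average B \<mu> (indicator A) x r = emeasure \<mu> (A \<inter> B x r) / emeasure \<mu> (B x r)"
proof -
  have "(\<integral>\<^sup>+ y\<in>B x r. indicator A y \<partial>\<mu>) = (\<integral>\<^sup>+ y. indicator (A \<inter> B x r) y \<partial>\<mu>)"
    by (intro nn_integral_cong) (simp split: split_indicator)
  also have "\<dots> = emeasure \<mu> (A \<inter> B x r)"
    using assms by (intro nn_integral_indicator sets.Int B_sets)
  finally show ?thesis
    unfolding ball_average_def by simp
qed

lemma ball_average_indicator_le_1:
  assumes "A \<in> sets \<mu>"
  shows "ball_average B \<mu> (indicator A) x r \<le> 1"
proof -
  have "emeasure \<mu> (A \<inter> B x r) \<le> emeasure \<mu> (B x r)"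
    by (intro emeasure_mono) auto
  then show ?thesis
    \<comment> \<open>On a null ball the average is 0 / 0, which is 0 in
      \<open>ennreal\<close>.\<close>
    unfolding ball_average_indicator[OF assms]
    by (cases "emeasure \<mu> (B x r) = 0")
      (auto intro!: divide_le_posI_ennreal simp: zero_less_iff_neq_zero)
qed

lemma local_le_maximal_function: "local_maximal_function B \<mu> R f x \<le> maximal_function B \<mu> f x"
  unfolding local_maximal_function_def maximal_function_def
  by (rule SUP_subset_mono) auto

lemma indicator_L1_loc:
  assumes "A \<in> sets \<mu>"
  shows "indicator A \<in> L1_loc \<mu>"
proof -
  have "set_integrable \<mu> (ball x r) (indicator A :: 'a \<Rightarrow> real)" for x r
  proof -
    have b: "ball x r \<in> sets \<mu>" by (intro borel_sets) auto
    have "emeasure \<mu> (ball x r \<inter> A) \<le> emeasure \<mu> (ball x r)"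
      using b by (intro emeasure_mono) auto
    also have "\<dots> < \<infinity>" by (intro bounded_finite) auto
    finally show ?thesis
      unfolding set_integrable_def using b assms
      by (simp add: indicator_inter_arith[symmetric] sets.Int integrable_real_indicator)
  qed
  then show ?thesis
    using assms unfolding L1_loc_def by auto
qed

text \<open>If \<open>A\<close> lies in \<open>B x R\<close>, a ball of radius \<open>r > R\<close> gives \<open>A\<close> at most the average over \<open>B x R\<close>,
  so large radii do not contribute to the maximal function at \<open>x\<close>.\<close>

lemma maximal_function_small_set:
  assumes A: "A \<in> sets \<mu>" and F: "F \<in> sets \<mu>" and "A \<subseteq> F" and "A \<subseteq> B x R" and "0 < R"
  shows "maximal_function B \<mu> (indicator A) x \<le> (SUP r\<in>{0<..R}. ball_average B \<mu> (indicator F) x r)"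
  unfolding maximal_function_def
proof (rule SUP_least)
  fix r assume "r \<in> {r. 0 < r \<and> 0 < emeasure \<mu> (B x r)}"
  then have "0 < r" by simp
  have ind: "(\<lambda>y. ennreal \<bar>indicator A y :: real\<bar>) = indicator A"
    by (auto split: split_indicator)
  \<comment> \<open>Each admissible radius \<open>r\<close> of the maximal function is matched with
    the radius \<open>min r R\<close>.\<close>
  have "ball_average B \<mu> (indicator A) x r \<le> ball_average B \<mu> (indicator F) x (min r R)"
  proof (cases "r \<le> R")
    case True
    have "emeasure \<mu> (A \<inter> B x r) \<le> emeasure \<mu> (F \<inter> B x r)"
      using F \<open>A \<subseteq> F\<close> by (intro emeasure_mono) auto
    then show ?thesis
      using True A F by (simp add: ball_average_indicator divide_right_mono_ennreal)
  next
    case False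
    \<comment> \<open>Passing from \<open>r\<close> down to \<open>R\<close> loses nothing of
      \<open>A\<close>, which lies in \<open>B x R\<close>, and can only shrink the
      denominator.\<close>
    have "emeasure \<mu> (A \<inter> B x r) \<le> emeasure \<mu> (F \<inter> B x R)"
      using F \<open>A \<subseteq> F\<close> \<open>A \<subseteq> B x R\<close> by (intro emeasure_mono) auto
    moreover have "emeasure \<mu> (B x R) \<le> emeasure \<mu> (B x r)"
      using False B_mono by (intro emeasure_mono) auto
    ultimately show ?thesis
      using False A F
      by (simp add: ball_average_indicator divide_ennreal_def mult_mono inverse_ennreal_antimono)
  qed
  also have "\<dots> \<le> (SUP r\<in>{0<..R}. ball_average B \<mu> (indicator F) x r)"
    using \<open>0 < r\<close> \<open>0 < R\<close> by (intro SUP_upper) auto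
  finally show "ball_average B \<mu> (\<lambda>y. ennreal \<bar>indicator A y\<bar>) x r \<le> \<dots>"
    unfolding ind .
qed

text \<open>Total boundedness supplies finitely many small pieces covering \<open>F\<close>. The
  maximal inequality for each piece has its own exceptional null set, and finitely many of these
  unite to a null set.\<close>

lemma maximal_imp_SUP_average:
  assumes max: "\<forall>f\<in>L1_loc \<mu>. AE x in \<mu>. maximal_function B \<mu> f x \<ge> ennreal \<bar>f x\<bar>"
    and F: "closed F" "totally_bounded F" and R: "0 < R"
  shows "AE x in \<mu>. x \<in> F \<longrightarrow> 1 \<le> (SUP r\<in>{0<..R}. ball_average B \<mu> (indicator F) x r)"
proof -
  obtain k where k: "finite k" "F \<subseteq> (\<Union>c\<in>k. {y. dist c y < R/2})"
    using F(2) R unfolding totally_bounded_metric by (meson half_gt_zero)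
  have Fs: "F \<in> sets \<mu>" using F(1) by (intro borel_sets) auto
  have "AE x in \<mu>. x \<in> F \<inter> ball c (R/2) \<longrightarrow>
      1 \<le> (SUP r\<in>{0<..R}. ball_average B \<mu> (indicator F) x r)" for c
  proof -
    let ?A = "F \<inter> ball c (R/2)"
    have As: "?A \<in> sets \<mu>" using F(1) by (intro borel_sets) auto
    have "AE x in \<mu>. ennreal \<bar>indicator ?A x\<bar> \<le> maximal_function B \<mu> (indicator ?A) x"
      using max indicator_L1_loc[OF As] by blast
    then show ?thesis
    proof (rule AE_mp, intro AE_I2 impI)
      fix x assume le: "ennreal \<bar>indicator ?A x\<bar> \<le> maximal_function B \<mu> (indicator ?A) x"
        and x: "x \<in> ?A"
      \<comment> \<open>With radius \<open>R/2\<close> the piece lies in the ball of radius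
        \<open>R\<close> about each of its own points \<open>x\<close>, as the comparison of radii
        requires.\<close>
      have "?A \<subseteq> ball x R"
      proof
        fix y assume y: "y \<in> ?A"
        have "dist x y \<le> dist c x + dist c y"
          by (metis dist_commute dist_triangle)
        then show "y \<in> ball x R" using x y by auto
      qed
      then have "maximal_function B \<mu> (indicator ?A) x
          \<le> (SUP r\<in>{0<..R}. ball_average B \<mu> (indicator F) x r)"
        using ball_subset[of x R] R by (intro maximal_function_small_set As Fs) auto
      then show "1 \<le> (SUP r\<in>{0<..R}. ball_average B \<mu> (indicator F) x r)"
        using le x by simp
    qed
  qed
  then have "AE x in \<mu>. \<forall>c\<in>k. x \<in> F \<inter> ball c (R/2) \<longrightarrow>
      1 \<le> (SUP r\<in>{0<..R}. ball_average B \<mu> (indicator F) x r)"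
    using k(1) by (intro AE_finite_allI)
  then show ?thesis
    by (rule AE_mp) (use k(2) in \<open>auto simp: subset_iff\<close>)
qed

text \<open>On \<open>F\<close> the averages never exceed 1, and they have supremum at least 1 at
  arbitrarily small scales almost everywhere. Off \<open>F\<close>, closedness makes them vanish for
  all small radii.\<close>

lemma maximal_imp_density:
  assumes max: "\<forall>f\<in>L1_loc \<mu>. AE x in \<mu>. maximal_function B \<mu> f x \<ge> ennreal \<bar>f x\<bar>"
    and F: "closed F" "totally_bounded F"
  shows "AE x in \<mu>. Limsup (at_right 0) (\<lambda>r. ball_average B \<mu> (indicator F) x r) = indicator F x"
proof -
  have Fs: "F \<in> sets \<mu>" using F(1) by (intro borel_sets) auto
  \<comment> \<open>Only the scales 1/(n+1) are used, so a single null set serves for all of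
    them.\<close>
  have "AE x in \<mu>. \<forall>n. x \<in> F \<longrightarrow>
      1 \<le> (SUP r\<in>{0<..inverse (real (Suc n))}. ball_average B \<mu> (indicator F) x r)"
    unfolding AE_all_countable
    using maximal_imp_SUP_average[OF max F] by auto
  then show ?thesis
  proof (rule AE_mp, intro AE_I2 impI)
    fix x assume *: "\<forall>n. x \<in> F \<longrightarrow>
      1 \<le> (SUP r\<in>{0<..inverse (real (Suc n))}. ball_average B \<mu> (indicator F) x r)"
    show "Limsup (at_right 0) (\<lambda>r. ball_average B \<mu> (indicator F) x r) = indicator F x"
    proof (cases "x \<in> F")
      case True
      have "Limsup (at_right 0) (\<lambda>r. ball_average B \<mu> (indicator F) x r) \<le> 1"
        using ball_average_indicator_le_1[OF Fs] by (intro Limsup_bounded) auto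
      moreover have "1 \<le> Limsup (at_right 0) (\<lambda>r. ball_average B \<mu> (indicator F) x r)"
        using * True by (intro le_Limsup_at_right) auto
      ultimately show ?thesis using True by simp
    next
      case False
      then obtain e where e: "0 < e" "ball x e \<subseteq> - F"
        using F(1) open_contains_ball[of "- F"] by auto
      have "ball_average B \<mu> (indicator F) x r = 0" if "0 < r" "r < e" for r
      proof -
        have "B x r \<subseteq> ball x e"
          using subset_cball[of x r] that by auto
        then have "F \<inter> B x r = {}" using e(2) by auto
        then show ?thesis using ball_average_indicator[OF Fs] by simp
      qed
      then have "eventually (\<lambda>r. ball_average B \<mu> (indicator F) x r = 0) (at_right 0)"
        unfolding eventually_at_right_field using e(1) by (intro exI[of _ e]) auto
      then have "Limsup (at_right 0) (\<lambda>r. ball_average B \<mu> (indicator F) x r) =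
          Limsup (at_right (0::real)) (\<lambda>r. 0)"
        by (rule Limsup_eq)
      also have "\<dots> = 0" by (rule Limsup_const) simp
      finally show ?thesis using False by simp
    qed
  qed
qed

text \<open>The function \<open>|f|\<close> dominates \<open>q\<close> times the indicator of
  \<open>F\<close>, so its averages dominate \<open>q\<close> times those of
  \<open>F\<close>.\<close>

lemma cmult_average_le_local_maximal:
  assumes F: "F \<in> sets \<mu>" and q: "\<And>y. y \<in> F \<Longrightarrow> q \<le> ennreal \<bar>f y\<bar>"
  shows "q * (SUP r\<in>{0<..R}. ball_average B \<mu> (indicator F) x r) \<le> local_maximal_function B \<mu> R f x"
  unfolding SUP_mult_left_ennreal
proof (rule SUP_least)
  fix r assume r: "r \<in> {0<..R}"
  show "q * ball_average B \<mu> (indicator F) x r \<le> local_maximal_function B \<mu> R f x"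
  proof (cases "emeasure \<mu> (B x r) = 0")
    \<comment> \<open>A null ball is excluded from the supremum in
      \<open>local_maximal_function\<close> but not from the one on the left; there its average is 0
      / 0 = 0.\<close>
    case True
    then have "emeasure \<mu> (F \<inter> B x r) = 0"
      using emeasure_mono[of "F \<inter> B x r" "B x r" \<mu>] by auto
    then show ?thesis
      using ball_average_indicator[OF F] by simp
  next
    case False
    have "q * ball_average B \<mu> (indicator F) x r =
        (\<integral>\<^sup>+ y. q * (indicator F y * indicator (B x r) y) \<partial>\<mu>) / emeasure \<mu> (B x r)"
      unfolding ball_average_def using F
      by (simp add: nn_integral_cmult ennreal_times_divide)
    also have "\<dots> \<le> ball_average B \<mu> (\<lambda>y. ennreal \<bar>f y\<bar>) x r"
      unfolding ball_average_def using q
      by (intro divide_right_mono_ennreal nn_integral_mono) (auto split: split_indicator)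
    also have "\<dots> \<le> local_maximal_function B \<mu> R f x"
      unfolding local_maximal_function_def using r False
      by (intro SUP_upper) (auto simp: zero_less_iff_neq_zero)
    finally show ?thesis .
  qed
qed

lemma density_imp_local_maximal:
  assumes dens: "\<And>F. closed F \<Longrightarrow> totally_bounded F \<Longrightarrow> F \<subseteq> msupp \<mu> \<Longrightarrow>
      AE x in \<mu>. Limsup (at_right 0) (\<lambda>r. ball_average B \<mu> (indicator F) x r) = indicator F x"
    and f: "f \<in> borel_measurable \<mu>" and R: "0 < R"
  shows "AE x in \<mu>. local_maximal_function B \<mu> R f x \<ge> ennreal \<bar>f x\<bar>"
proof -
  define A where "A q = {x. q < \<bar>f x\<bar>}" for q :: real
  have "A q \<in> sets \<mu>" for q
  proof -
    have "{x \<in> space \<mu>. q < \<bar>f x\<bar>} \<in> sets \<mu>" using f by measurable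
    then show ?thesis unfolding A_def space_\<mu> by simp
  qed
  then have "\<exists>F :: nat \<times> nat \<Rightarrow> 'a set. (\<forall>i. closed (F i) \<and> totally_bounded (F i) \<and>
      F i \<subseteq> A q \<inter> msupp \<mu>) \<and> A q - (\<Union>i. F i) \<in> null_sets \<mu>" for q
    using measurable_exhaustion[OF mms] by blast
  then obtain F :: "real \<Rightarrow> nat \<times> nat \<Rightarrow> 'a set"
    where F: "\<And>q i. closed (F q i)" "\<And>q i. totally_bounded (F q i)" "\<And>q i. F q i \<subseteq> A q \<inter> msupp \<mu>"
      and null: "\<And>q. A q - (\<Union>i. F q i) \<in> null_sets \<mu>"
    by metis
  \<comment> \<open>Rational levels and a countable index set keep the union of all exceptional sets
    null.\<close>
  have "AE x in \<mu>. \<forall>q\<in>\<rat>. \<forall>i.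
      Limsup (at_right 0) (\<lambda>r. ball_average B \<mu> (indicator (F q i)) x r) = indicator (F q i) x"
  proof (intro AE_ball_countable' countable_rat, unfold AE_all_countable, intro allI dens)
    show "F q i \<subseteq> msupp \<mu>" for q i using F(3) by blast
  qed (rule F)+
  moreover have "AE x in \<mu>. \<forall>q\<in>\<rat>. x \<notin> A q - (\<Union>i. F q i)"
    using null by (intro AE_ball_countable' countable_rat AE_not_in)
  ultimately show ?thesis
  proof eventually_elim
    case (elim x)
    show ?case
    proof (rule dense_le)
      \<comment> \<open>It suffices to reach every \<open>y\<close> below the value of
        \<open>|f|\<close> at \<open>x\<close>. Such a \<open>y\<close> is a finite
        \<open>b \<ge> 0\<close>, so the rational level \<open>q\<close> chosen above
        \<open>b\<close> is positive.\<close>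
      fix y assume y: "y < ennreal \<bar>f x\<bar>"
      then obtain b where b: "y = ennreal b" "0 \<le> b"
        by (cases y) auto
      then have "b < \<bar>f x\<bar>"
        using y by (simp add: ennreal_less_iff)
      then obtain q where q: "q \<in> \<rat>" "b < q" "q < \<bar>f x\<bar>"
        using Rats_dense_in_real by blast
      then obtain i where i: "x \<in> F q i"
        using elim(2) unfolding A_def by blast
      \<comment> \<open>At a point of \<open>F q i\<close> outside the null set the upper limit of
        the averages equals 1, and the supremum over radii up to \<open>R\<close> bounds it from
        above.\<close>
      have "1 \<le> (SUP r\<in>{0<..R}. ball_average B \<mu> (indicator (F q i)) x r)"
        using spec[OF bspec[OF elim(1) q(1)], of i] i Limsup_at_right_le_SUP[OF R, of "ball_average B \<mu> (indicator (F q i)) x"]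
        by simp
      then have "ennreal q * 1 \<le> ennreal q * (SUP r\<in>{0<..R}. ball_average B \<mu> (indicator (F q i)) x r)"
        by (rule mult_left_mono) simp
      also have "\<dots> \<le> local_maximal_function B \<mu> R f x"
      proof (rule cmult_average_le_local_maximal)
        show "F q i \<in> sets \<mu>" using F(1) by (intro borel_sets) auto
        show "ennreal q \<le> ennreal \<bar>f y\<bar>" if "y \<in> F q i" for y
          using that F(3)[of q i] unfolding A_def by (intro ennreal_leI) auto
      qed
      finally show "y \<le> local_maximal_function B \<mu> R f x"
        using b q(2) order_trans[OF ennreal_leI[of b q]] by simp
    qed
  qed
qed

text \<open>The implications are proved in a cycle; the way back from the localized to the full
  maximal function needs just one value of \<open>R\<close>, taken to be 1.\<close>

lemma maximal_density_local_maximal_equiv: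
  "((\<forall>f\<in>L1_loc \<mu>. AE x in \<mu>. maximal_function B \<mu> f x \<ge> ennreal \<bar>f x\<bar>)
     \<longleftrightarrow>
     (\<forall>F. closed F \<and> totally_bounded F \<and> F \<subseteq> msupp \<mu> \<longrightarrow>
       (AE x in \<mu>. Limsup (at_right 0) (\<lambda>r. ball_average B \<mu> (indicator F) x r) = indicator F x))) \<and>
   ((\<forall>F. closed F \<and> totally_bounded F \<and> F \<subseteq> msupp \<mu> \<longrightarrow>
       (AE x in \<mu>. Limsup (at_right 0) (\<lambda>r. ball_average B \<mu> (indicator F) x r) = indicator F x))
     \<longleftrightarrow>
     (\<forall>f\<in>L1_loc \<mu>. \<forall>R>0. AE x in \<mu>. local_maximal_function B \<mu> R f x \<ge> ennreal \<bar>f x\<bar>))"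
  (is "(?max \<longleftrightarrow> ?dens) \<and> (?dens \<longleftrightarrow> ?loc)")
proof -
  have "?max \<Longrightarrow> ?dens"
    using maximal_imp_density by blast
  moreover have "?dens \<Longrightarrow> ?loc"
    using density_imp_local_maximal unfolding L1_loc_def by blast
  moreover have "?max" if ?loc
  proof
    fix f assume "f \<in> L1_loc \<mu>"
    then have "AE x in \<mu>. local_maximal_function B \<mu> 1 f x \<ge> ennreal \<bar>f x\<bar>"
      using that by simp
    then show "AE x in \<mu>. maximal_function B \<mu> f x \<ge> ennreal \<bar>f x\<bar>"
      by (rule AE_mp) (auto intro: order_trans[OF _ local_le_maximal_function])
  qed
  ultimately show ?thesis by blast
qed

end

theorem theorem3p1:
  fixes \<mu> :: "'a::metric_space measure"
  assumes "metric_measure_space \<mu>"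
  shows "(((\<forall>f\<in>L1_loc \<mu>. AE x in \<mu>. maximal_function cball \<mu> f x \<ge> ennreal \<bar>f x\<bar>)
           \<longleftrightarrow>
           (\<forall>F. closed F \<and> totally_bounded F \<and> F \<subseteq> msupp \<mu> \<longrightarrow>
             (AE x in \<mu>. Limsup (at_right 0) (\<lambda>r. ball_average cball \<mu> (indicator F) x r) = indicator F x))) \<and>
           ((\<forall>F. closed F \<and> totally_bounded F \<and> F \<subseteq> msupp \<mu> \<longrightarrow>
             (AE x in \<mu>. Limsup (at_right 0) (\<lambda>r. ball_average cball \<mu> (indicator F) x r) = indicator F x))
           \<longleftrightarrow>
           (\<forall>f\<in>L1_loc \<mu>. \<forall>R>0. AE x in \<mu>. local_maximal_function cball \<mu> R f x \<ge> ennreal \<bar>f x\<bar>))) \<and>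
         (((\<forall>f\<in>L1_loc \<mu>. AE x in \<mu>. maximal_function ball \<mu> f x \<ge> ennreal \<bar>f x\<bar>)
           \<longleftrightarrow>
           (\<forall>F. closed F \<and> totally_bounded F \<and> F \<subseteq> msupp \<mu> \<longrightarrow>
             (AE x in \<mu>. Limsup (at_right 0) (\<lambda>r. ball_average ball \<mu> (indicator F) x r) = indicator F x))) \<and>
           ((\<forall>F. closed F \<and> totally_bounded F \<and> F \<subseteq> msupp \<mu> \<longrightarrow>
             (AE x in \<mu>. Limsup (at_right 0) (\<lambda>r. ball_average ball \<mu> (indicator F) x r) = indicator F x))
           \<longleftrightarrow>
           (\<forall>f\<in>L1_loc \<mu>. \<forall>R>0. AE x in \<mu>. local_maximal_function ball \<mu> R f x \<ge> ennreal \<bar>f x\<bar>)))"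
proof -
  interpret closed_balls: ball_system \<mu> cball
    using assms by unfold_locales auto
  interpret open_balls: ball_system \<mu> ball
    using assms by unfold_locales auto
  show ?thesis
    by (rule conjI[OF closed_balls.maximal_density_local_maximal_equiv
        open_balls.maximal_density_local_maximal_equiv])
qed

end
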